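(* Let $R$ be a simple rotation of $\mathbb{R}^n$. Then its angle of rotation is $$\theta=\cos^{-1}\tfrac12\bigl(\mathrm{tr}(R)-n+2\bigr).$$ Moreover, if $0<\theta<\pi$, then $R=\exp(f)$, where $$f=\frac{\theta}{2\sin\theta}(R-R^t).$$
   Context: A two-plane is a two-dimensional linear subspace of $\mathbb{R}^n$. A simple rotation is a linear map that acts as a rotation in some two-plane and fixes the orthogonal complement of that two-plane pointwise. The angle of rotation is taken in $[0,\pi]$ (reversing the orientation of the two-plane if necessary), and $\cos^{-1}$ takes values in $[0,\pi]$. $R^t$ is the transpose of $R$ and $\exp(A)=\sum_{k\ge0}A^k/k!$. *)

theory Defs
  imports "HOL-Analysis.Analysis"
begin

text \<open>Linear maps of Euclidean space are given by their matrices in the standard basis,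
  acting by \<open>R *v x\<close>.\<close>

definition two_plane :: "(real ^ 'n) set \<Rightarrow> bool"
  where "two_plane P \<longleftrightarrow> subspace P \<and> dim P = 2"

text \<open>The ordered orthonormal basis \<open>u, v\<close> fixes an orientation of the plane; exchanging
  \<open>u\<close> and \<open>v\<close> replaces the angle \<open>\<theta>\<close> by \<open>-\<theta>\<close>.\<close>

definition rotates_plane :: "real ^ 'n ^ 'n \<Rightarrow> (real ^ 'n) set \<Rightarrow> real \<Rightarrow> bool"
  where "rotates_plane R P \<theta> \<longleftrightarrow>
    (\<exists>u v. norm u = 1 \<and> norm v = 1 \<and> orthogonal u v \<and> span {u, v} = P \<and>
      R *v u = cos \<theta> *\<^sub>R u + sin \<theta> *\<^sub>R v \<and>
      R *v v = - sin \<theta> *\<^sub>R u + cos \<theta> *\<^sub>R v)"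

definition simple_rotation_by :: "real ^ 'n ^ 'n \<Rightarrow> (real ^ 'n) set \<Rightarrow> real \<Rightarrow> bool"
  where "simple_rotation_by R P \<theta> \<longleftrightarrow>
    two_plane P \<and> rotates_plane R P \<theta> \<and> (\<forall>x \<in> P\<^sup>\<bottom>. R *v x = x)"

text \<open>The identity counts as a simple rotation, with angle \<open>0\<close>.\<close>

definition simple_rotation :: "real ^ 'n ^ 'n \<Rightarrow> bool"
  where "simple_rotation R \<longleftrightarrow> (\<exists>P \<theta>. simple_rotation_by R P \<theta>)"

text \<open>The angle of rotation is a relation here: existence and uniqueness are claims.\<close>

definition is_rotation_angle :: "real ^ 'n ^ 'n \<Rightarrow> real \<Rightarrow> bool"
  where "is_rotation_angle R \<theta> \<longleftrightarrow> 0 \<le> \<theta> \<and> \<theta> \<le> pi \<and> (\<exists>P. simple_rotation_by R P \<theta>)"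

text \<open>The operations \<open>*\<close> and \<open>^\<close> on \<open>real ^ 'n ^ 'n\<close> act entrywise, so the powers in the
  exponential series are iterates of the matrix product \<open>**\<close>.\<close>

primrec mat_pow :: "real ^ 'n ^ 'n \<Rightarrow> nat \<Rightarrow> real ^ 'n ^ 'n"
  where
    "mat_pow A 0 = mat 1"
  | "mat_pow A (Suc k) = A ** mat_pow A k"

definition mat_exp :: "real ^ 'n ^ 'n \<Rightarrow> real ^ 'n ^ 'n"
  where "mat_exp A = (\<Sum>k. mat_pow A k /\<^sub>R fact k)"

lemma mat_pow_component_le:
  fixes A :: "real ^ 'n ^ 'n"
  assumes "\<And>i j. \<bar>A $ i $ j\<bar> \<le> M"
  shows "\<bar>mat_pow A k $ i $ j\<bar> \<le> (real CARD('n) * M) ^ k"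
proof (induction k arbitrary: i j)
  case 0
  show ?case by (simp add: mat_def)
next
  case (Suc k)
  have "0 \<le> M" using assms[of i j] by linarith
  have "\<bar>mat_pow A (Suc k) $ i $ j\<bar> \<le> (\<Sum>l\<in>UNIV. \<bar>A $ i $ l * mat_pow A k $ l $ j\<bar>)"
    by (simp add: matrix_matrix_mult_def sum_abs)
  also have "\<dots> \<le> (\<Sum>l\<in>(UNIV::'n set). M * (real CARD('n) * M) ^ k)"
    unfolding abs_mult using assms Suc.IH \<open>0 \<le> M\<close> by (intro sum_mono mult_mono) auto
  finally show ?case by (simp add: mult.assoc)
qed

lemma summable_mat_exp:
  fixes A :: "real ^ 'n ^ 'n"
  shows "summable (\<lambda>k. mat_pow A k /\<^sub>R fact k)"
proof -
  define M where "M = norm A"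
  have M: "\<bar>A $ i $ j\<bar> \<le> M" for i j
    unfolding M_def
    using component_le_norm_cart[of "A $ i" j] Finite_Cartesian_Product.norm_nth_le[of A i]
    by linarith
  let ?c = "real CARD('n) * M"
  have le: "norm X \<le> (\<Sum>i\<in>UNIV. \<Sum>j\<in>UNIV. \<bar>X $ i $ j\<bar>)" for X :: "real ^ 'n ^ 'n"
  proof -
    have "norm X \<le> (\<Sum>i\<in>UNIV. norm (X $ i))"
      unfolding norm_vec_def by (intro L2_set_le_sum) auto
    also have "\<dots> \<le> (\<Sum>i\<in>UNIV. \<Sum>j\<in>UNIV. \<bar>X $ i $ j\<bar>)"
      by (intro sum_mono norm_le_l1_cart)
    finally show ?thesis .
  qed
  have "norm (mat_pow A k /\<^sub>R fact k) \<le> (real CARD('n))\<^sup>2 * (?c ^ k /\<^sub>R fact k)" for k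
  proof -
    have "norm (mat_pow A k) \<le> (\<Sum>i\<in>(UNIV::'n set). \<Sum>j\<in>(UNIV::'n set). ?c ^ k)"
      by (rule order_trans[OF le]) (intro sum_mono mat_pow_component_le M)
    also have "\<dots> = (real CARD('n))\<^sup>2 * ?c ^ k"
      by (simp add: power2_eq_square mult.assoc)
    finally have "inverse (fact k) * norm (mat_pow A k) \<le>
        inverse (fact k) * ((real CARD('n))\<^sup>2 * ?c ^ k)"
      by (rule mult_left_mono) simp
    then show ?thesis
      by (simp add: mult.left_commute)
  qed
  moreover have "summable (\<lambda>k. (real CARD('n))\<^sup>2 * (?c ^ k /\<^sub>R fact k))"
    by (intro summable_mult summable_exp_generic)
  ultimately show ?thesis
    by (rule summable_comparison_test'[where N = 0, rotated])
qed

end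

theory Submission
  imports Defs
begin

text \<open>
  Fix an orthonormal basis \<open>u, v\<close> of the plane of rotation. Let \<open>Q\<close> be the orthogonal projection
  onto the plane, and let \<open>J\<close> be the quarter turn \<open>u \<mapsto> v \<mapsto> -u\<close> of the plane, extended by
  \<open>0\<close> on the orthogonal complement. The simple rotation by \<open>\<theta>\<close> is
    \<open>R = (1 - Q) + cos \<theta> Q + sin \<theta> J\<close> (\<open>simple_rotation_by_eq\<close>), and everything is read off
  from this formula.

  Angle: \<open>Q\<close> has trace \<open>2\<close> and \<open>J\<close> has trace \<open>0\<close>, so \<open>tr R = n - 2 + 2 cos \<theta>\<close>. On \<open>[0, \<pi>]\<close>
  the cosine is injective, so \<open>\<theta>\<close> is unique and equals the stated arc cosine. It
  exists because a given angle may be reduced to \<open>arccos (cos \<theta>)\<close>, after an exchange of \<open>u\<close> and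
  \<open>v\<close> if \<open>sin \<theta> < 0\<close>.

  Exponential: \<open>Q\<close> is symmetric and \<open>J\<close> is antisymmetric, so \<open>R - R\<^sup>t = 2 sin \<theta> J\<close>.
  If \<open>0 < \<theta> < \<pi>\<close>, then \<open>sin \<theta> \<noteq> 0\<close> and the exponent in the theorem is \<open>\<theta> J\<close>. Since \<open>J\<^sup>2 = -Q\<close> and \<open>Q\<close> is an identity for \<open>J\<close>, the matrices
  \<open>a Q + b J\<close> multiply like the complex numbers \<open>a + b \<i>\<close>. So the exponential series
  of \<open>\<theta> J\<close> sums to \<open>(1 - Q) + cos \<theta> Q + sin \<theta> J\<close>, by Euler's formula.
\<close>

definition plane_projection :: "real ^ 'n \<Rightarrow> real ^ 'n \<Rightarrow> real ^ 'n ^ 'n"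
  where "plane_projection u v = (\<chi> i j. u $ i * u $ j + v $ i * v $ j)"

definition quarter_turn :: "real ^ 'n \<Rightarrow> real ^ 'n \<Rightarrow> real ^ 'n ^ 'n"
  where "quarter_turn u v = (\<chi> i j. v $ i * u $ j - u $ i * v $ j)"

lemma plane_projection_mult_vec:
  "plane_projection u v *v x = (u \<bullet> x) *\<^sub>R u + (v \<bullet> x) *\<^sub>R v"
  by (simp add: vec_eq_iff plane_projection_def matrix_vector_mult_def inner_vec_def
      sum_distrib_left sum.distrib algebra_simps)

lemma quarter_turn_mult_vec:
  "quarter_turn u v *v x = (u \<bullet> x) *\<^sub>R v - (v \<bullet> x) *\<^sub>R u"
  by (simp add: vec_eq_iff quarter_turn_def matrix_vector_mult_def inner_vec_def
      sum_distrib_left sum_subtractf algebra_simps)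

lemma trace_plane_projection:
  assumes "norm u = 1" "norm v = 1"
  shows "trace (plane_projection u v) = 2"
proof -
  have "trace (plane_projection u v) = u \<bullet> u + v \<bullet> v"
    by (simp add: trace_def plane_projection_def inner_vec_def sum.distrib)
  then show ?thesis
    using assms by (simp add: dot_square_norm)
qed

lemma trace_quarter_turn: "trace (quarter_turn u v) = 0"
  by (simp add: trace_def quarter_turn_def mult.commute)

lemma trace_scaleR: "trace (c *\<^sub>R A) = c * trace (A :: real ^ 'n ^ 'n)"
  by (simp add: trace_def sum_distrib_left)

text \<open>Both sides are linear, so it suffices to compare them on \<open>u\<close>, \<open>v\<close> and the component
  \<open>y = x - (u \<bullet> x) u - (v \<bullet> x) v\<close> of \<open>x\<close> orthogonal to the plane, which \<open>R\<close> fixes.\<close>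

lemma simple_rotation_by_eq:
  fixes R :: "real ^ 'n ^ 'n"
  assumes "simple_rotation_by R P \<theta>"
  obtains u v where "norm u = 1" "norm v = 1" "orthogonal u v"
    "R = mat 1 - plane_projection u v + cos \<theta> *\<^sub>R plane_projection u v
      + sin \<theta> *\<^sub>R quarter_turn u v"
proof -
  from assms obtain u v where uv: "norm u = 1" "norm v = 1" "orthogonal u v" "span {u, v} = P"
      and Ru: "R *v u = cos \<theta> *\<^sub>R u + sin \<theta> *\<^sub>R v"
      and Rv: "R *v v = - sin \<theta> *\<^sub>R u + cos \<theta> *\<^sub>R v"
      and fix_comp: "\<forall>x \<in> P\<^sup>\<bottom>. R *v x = x"
    by (auto simp: simple_rotation_by_def rotates_plane_def)
  have ip: "u \<bullet> u = 1" "v \<bullet> v = 1" "u \<bullet> v = 0" "v \<bullet> u = 0"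
    using uv by (simp_all add: dot_square_norm orthogonal_def inner_commute)
  have "R *v x = (mat 1 - plane_projection u v + cos \<theta> *\<^sub>R plane_projection u v
      + sin \<theta> *\<^sub>R quarter_turn u v) *v x" for x
  proof -
    define y where "y = x - (u \<bullet> x) *\<^sub>R u - (v \<bullet> x) *\<^sub>R v"
    have "orthogonal y z" if "z \<in> span {u, v}" for z
      by (rule orthogonal_to_span[OF that])
        (auto simp: y_def orthogonal_def inner_diff_left inner_diff_right ip inner_commute)
    then have "y \<in> P\<^sup>\<bottom>"
      using uv(4) by (auto simp: orthogonal_comp_def orthogonal_commute)
    then have Ry: "R *v y = y"
      using fix_comp by blast
    have "R *v x = R *v (y + (u \<bullet> x) *\<^sub>R u + (v \<bullet> x) *\<^sub>R v)"
      by (simp add: y_def)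
    also have "\<dots> = y + (u \<bullet> x) *\<^sub>R (R *v u) + (v \<bullet> x) *\<^sub>R (R *v v)"
      by (simp add: matrix_vector_right_distrib matrix_vector_mult_scaleR Ry)
    finally show ?thesis
      by (simp add: Ru Rv y_def matrix_vector_mult_add_rdistrib matrix_vector_mult_diff_rdistrib
          scaleR_matrix_vector_assoc[symmetric] plane_projection_mult_vec quarter_turn_mult_vec
          algebra_simps)
  qed
  then have "R = mat 1 - plane_projection u v + cos \<theta> *\<^sub>R plane_projection u v
      + sin \<theta> *\<^sub>R quarter_turn u v"
    by (simp add: matrix_eq)
  with uv that show ?thesis by blast
qed

lemma trace_simple_rotation_by:
  fixes R :: "real ^ 'n ^ 'n"
  assumes "simple_rotation_by R P \<theta>"
  shows "trace R = real CARD('n) - 2 + 2 * cos \<theta>"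
proof -
  obtain u v :: "real ^ 'n" where uv: "norm u = 1" "norm v = 1" and
    R: "R = mat 1 - plane_projection u v + cos \<theta> *\<^sub>R plane_projection u v
      + sin \<theta> *\<^sub>R quarter_turn u v"
    using simple_rotation_by_eq[OF assms] by blast
  show ?thesis
    by (simp add: R trace_add trace_sub trace_I trace_scaleR trace_quarter_turn
        trace_plane_projection[OF uv])
qed

lemma is_rotation_angle_eq_arccos:
  fixes R :: "real ^ 'n ^ 'n"
  assumes "is_rotation_angle R \<theta>"
  shows "\<theta> = arccos (1 / 2 * (trace R - real CARD('n) + 2))"
proof -
  from assms obtain P where "0 \<le> \<theta>" "\<theta> \<le> pi" and P: "simple_rotation_by R P \<theta>"
    by (auto simp: is_rotation_angle_def)
  then show ?thesis
    by (simp add: trace_simple_rotation_by[OF P] arccos_cos)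
qed

text \<open>Only the sign of \<open>sin \<theta>\<close> is lost in the passage from \<open>\<theta>\<close> to \<open>arccos (cos \<theta>)\<close>,
  and reversing the orientation of the plane changes this sign.\<close>

lemma simple_rotation_has_angle:
  assumes "simple_rotation R"
  shows "\<exists>\<theta>. is_rotation_angle R \<theta>"
proof -
  from assms obtain P \<theta> where R: "simple_rotation_by R P \<theta>"
    by (auto simp: simple_rotation_def)
  then obtain u v where uv: "norm u = 1" "norm v = 1" "orthogonal u v" "span {u, v} = P"
      and Ru: "R *v u = cos \<theta> *\<^sub>R u + sin \<theta> *\<^sub>R v"
      and Rv: "R *v v = - sin \<theta> *\<^sub>R u + cos \<theta> *\<^sub>R v"
    by (auto simp: simple_rotation_by_def rotates_plane_def)
  define \<theta>' where "\<theta>' = arccos (cos \<theta>)"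
  have cos': "cos \<theta>' = cos \<theta>" and range: "0 \<le> \<theta>'" "\<theta>' \<le> pi"
    by (simp_all add: \<theta>'_def arccos_lbound arccos_ubound)
  have sin': "sin \<theta>' = \<bar>sin \<theta>\<bar>"
    by (simp add: \<theta>'_def sin_arccos_abs flip: sin_squared_eq)
  have "rotates_plane R P \<theta>'"
  proof (cases "sin \<theta> \<ge> 0")
    case True
    then show ?thesis
      unfolding rotates_plane_def cos' sin' using uv Ru Rv by fastforce
  next
    case False
    have "orthogonal v u" "span {v, u} = P"
      using uv by (simp_all add: orthogonal_commute insert_commute)
    moreover have "R *v v = cos \<theta>' *\<^sub>R v + sin \<theta>' *\<^sub>R u" "R *v u = - sin \<theta>' *\<^sub>R v + cos \<theta>' *\<^sub>R u"
      using False by (simp_all add: Ru Rv cos' sin')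
    ultimately show ?thesis
      unfolding rotates_plane_def using uv(1,2) by blast
  qed
  then have "simple_rotation_by R P \<theta>'"
    using R by (simp add: simple_rotation_by_def)
  then show ?thesis
    using range by (auto simp: is_rotation_angle_def)
qed

lemma quarter_turn_mult_plane_projection:
  assumes "norm u = 1" "norm v = 1" "orthogonal u v"
  shows "quarter_turn u v ** plane_projection u v = quarter_turn u v"
  using assms
  by (simp add: matrix_eq quarter_turn_mult_vec plane_projection_mult_vec orthogonal_def
      dot_square_norm inner_add_right inner_commute flip: matrix_vector_mul_assoc)

lemma minus_matrix_vector_mult: "(- A) *v x = - (A *v x)" for A :: "real ^ 'n ^ 'm"
  using matrix_vector_mult_diff_rdistrib[of 0 A x] by simp

lemma quarter_turn_squared:
  assumes "norm u = 1" "norm v = 1" "orthogonal u v"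
  shows "quarter_turn u v ** quarter_turn u v = - plane_projection u v"
  using assms
  by (simp add: matrix_eq quarter_turn_mult_vec plane_projection_mult_vec orthogonal_def
      dot_square_norm inner_diff_right inner_commute minus_matrix_vector_mult
      flip: matrix_vector_mul_assoc)

text \<open>The powers of \<open>\<theta> J\<close> mirror those of \<open>\<i> \<theta>\<close>: on the plane \<open>Q\<close> stands for \<open>1\<close> and \<open>J\<close> for
  \<open>\<i>\<close>. On the complement \<open>\<theta> J\<close> vanishes, so only its zeroth power, the
  identity, contributes \<open>1 - Q\<close>.\<close>

lemma mat_pow_quarter_turn:
  fixes u v :: "real ^ 'n"
  assumes "norm u = 1" "norm v = 1" "orthogonal u v"
  shows "mat_pow (\<theta> *\<^sub>R quarter_turn u v) k =
    (if k = 0 then mat 1 - plane_projection u v else 0)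
      + Re ((\<i> * of_real \<theta>) ^ k) *\<^sub>R plane_projection u v
      + Im ((\<i> * of_real \<theta>) ^ k) *\<^sub>R quarter_turn u v"
proof (induction k)
  case 0
  show ?case by simp
next
  case (Suc k)
  let ?J = "quarter_turn u v" and ?Q = "plane_projection u v"
  have JQ: "?J ** ?Q = ?J" and JJ: "?J ** ?J = - ?Q"
    using assms by (simp_all add: quarter_turn_mult_plane_projection quarter_turn_squared)
  have "?J ** (mat 1 - ?Q) = 0"
    using matrix_add_ldistrib[of ?J "mat 1 - ?Q" ?Q] by (simp add: JQ)
  then have vanish: "?J ** (if k = 0 then mat 1 - ?Q else 0) = 0"
    by simp
  show ?case
    by (simp add: Suc.IH matrix_add_ldistrib vanish JQ JJ matrix_scalar_ac mult.commute
        flip: scalar_matrix_assoc)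
qed

text \<open>Euler's formula, transported from \<open>\<complex>\<close> to the plane spanned by \<open>u\<close> and \<open>v\<close>.\<close>

lemma mat_exp_quarter_turn:
  fixes u v :: "real ^ 'n"
  assumes "norm u = 1" "norm v = 1" "orthogonal u v"
  shows "mat_exp (\<theta> *\<^sub>R quarter_turn u v) =
    mat 1 - plane_projection u v + cos \<theta> *\<^sub>R plane_projection u v
      + sin \<theta> *\<^sub>R quarter_turn u v"
proof -
  let ?J = "quarter_turn u v" and ?Q = "plane_projection u v"
  let ?z = "\<lambda>k. (\<i> * of_real \<theta>) ^ k /\<^sub>R fact k"
  have "?z sums exp (\<i> * of_real \<theta>)"
    by (rule exp_converges)
  then have z: "?z sums cis \<theta>"
    by (simp add: cis_conv_exp)
  have Re: "(\<lambda>k. Re (?z k)) sums cos \<theta>" and Im: "(\<lambda>k. Im (?z k)) sums sin \<theta>"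
    using sums_Re[OF z] sums_Im[OF z] by simp_all
  have const: "(\<lambda>k. if k = 0 then mat 1 - ?Q else 0) sums (mat 1 - ?Q)"
    using sums_single[of 0 "\<lambda>_. mat 1 - ?Q"] by simp
  have "(\<lambda>k. (if k = 0 then mat 1 - ?Q else 0) + Re (?z k) *\<^sub>R ?Q + Im (?z k) *\<^sub>R ?J)
      sums (mat 1 - ?Q + cos \<theta> *\<^sub>R ?Q + sin \<theta> *\<^sub>R ?J)"
    by (intro sums_add const sums_scaleR_left Re Im)
  moreover have "mat_pow (\<theta> *\<^sub>R ?J) k /\<^sub>R fact k =
      (if k = 0 then mat 1 - ?Q else 0) + Re (?z k) *\<^sub>R ?Q + Im (?z k) *\<^sub>R ?J" for k
    by (simp add: mat_pow_quarter_turn[OF assms] scaleR_add_right)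
  ultimately show ?thesis
    by (simp add: mat_exp_def sums_unique[symmetric])
qed

lemma rotation_matrix_diff_transpose:
  fixes R :: "real ^ 'n ^ 'n"
  assumes "R = mat 1 - plane_projection u v + cos \<theta> *\<^sub>R plane_projection u v
    + sin \<theta> *\<^sub>R quarter_turn u v"
  shows "R - transpose R = (2 * sin \<theta>) *\<^sub>R quarter_turn u v"
  by (simp add: assms vec_eq_iff transpose_def mat_def plane_projection_def
      quarter_turn_def algebra_simps)

theorem theorem3p6:
  fixes R :: "real ^ 'n ^ 'n"
  assumes "simple_rotation R"
  shows "(\<exists>!\<theta>. is_rotation_angle R \<theta>) \<and>
    (\<forall>\<theta>. is_rotation_angle R \<theta> \<longrightarrow>
      \<theta> = arccos (1 / 2 * (trace R - real CARD('n) + 2)) \<and>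
      (0 < \<theta> \<and> \<theta> < pi \<longrightarrow>
        R = mat_exp ((\<theta> / (2 * sin \<theta>)) *\<^sub>R (R - transpose R))))"
proof (intro conjI allI impI)
  show "\<exists>!\<theta>. is_rotation_angle R \<theta>"
    using simple_rotation_has_angle[OF assms] is_rotation_angle_eq_arccos by metis
next
  fix \<theta> assume "is_rotation_angle R \<theta>"
  then show "\<theta> = arccos (1 / 2 * (trace R - real CARD('n) + 2))"
    by (rule is_rotation_angle_eq_arccos)
next
  fix \<theta> assume "is_rotation_angle R \<theta>" and \<theta>: "0 < \<theta> \<and> \<theta> < pi"
  then obtain P where "simple_rotation_by R P \<theta>"
    by (auto simp: is_rotation_angle_def)
  then obtain u v where uv: "norm u = 1" "norm v = 1" "orthogonal u v"
    and R: "R = mat 1 - plane_projection u v + cos \<theta> *\<^sub>R plane_projection u v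
      + sin \<theta> *\<^sub>R quarter_turn u v"
    by (rule simple_rotation_by_eq)
  have "sin \<theta> \<noteq> 0"
    using \<theta> sin_gt_zero[of \<theta>] by simp
  then have "(\<theta> / (2 * sin \<theta>)) *\<^sub>R (R - transpose R) = \<theta> *\<^sub>R quarter_turn u v"
    by (simp add: rotation_matrix_diff_transpose[OF R])
  then show "R = mat_exp ((\<theta> / (2 * sin \<theta>)) *\<^sub>R (R - transpose R))"
    by (simp add: mat_exp_quarter_turn[OF uv] flip: R)
qed

end
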